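(* (1) Let $V$ be an object in a strict monoidal category $(\mathcal C,\otimes,\mathbf I)$ endowed with two morphisms $\mu:V\otimes V\to V$ and $\nu:\mathbf I\to V$, with $\nu$ a two-sided unit for $\mu$. The morphism $\sigma_{Ass}:=\nu\otimes\mu:V\otimes V\to V\otimes V$ is a pre-braiding if and only if $\mu$ is associative. (2) Let $V$ be an object in a symmetric preadditive strict monoidal category $(\mathcal C,\otimes,\mathbf I,c)$ endowed with two morphisms $[,]:V\otimes V\to V$ and $\nu:\mathbf I\to V$, with $\nu$ a Lie unit for $[,]$. Suppose additionally that there exists a normalized morphism $\gamma:V\to\mathbf I$, i.e. $\gamma\circ\nu=\mathrm{Id}_{\mathbf I}$. The morphism $\sigma_{Lei}:=c_{V,V}+\nu\otimes[,]:V\otimes V\to V\otimes V$ is a braiding if and only if $[,]$ satisfies the Leibniz condition.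
   Context: In a preadditive monoidal category, $\otimes$ is additive in each variable; $c$ denotes the symmetric braiding of $\mathcal C$. A pre-braiding on $V$ is a morphism $\sigma:V\otimes V\to V\otimes V$ with $(\sigma\otimes\mathrm{Id}_V)(\mathrm{Id}_V\otimes\sigma)(\sigma\otimes\mathrm{Id}_V)=(\mathrm{Id}_V\otimes\sigma)(\sigma\otimes\mathrm{Id}_V)(\mathrm{Id}_V\otimes\sigma)$; a braiding is an invertible pre-braiding. Two-sided unit: $\mu(\mathrm{Id}_V\otimes\nu)=\mu(\nu\otimes\mathrm{Id}_V)=\mathrm{Id}_V$. Associativity: $\mu(\mathrm{Id}_V\otimes\mu)=\mu(\mu\otimes\mathrm{Id}_V)$. Lie unit: $[,]\circ(\mathrm{Id}_V\otimes\nu)=[,]\circ(\nu\otimes\mathrm{Id}_V)=0$. Leibniz condition: $[,]\circ(\mathrm{Id}_V\otimes[,])=[,]\circ([,]\otimes\mathrm{Id}_V)-[,]\circ([,]\otimes\mathrm{Id}_V)\circ(\mathrm{Id}_V\otimes c_{V,V})$. *)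

theory Defs
  imports "HOL-Algebra.Group"
begin

section \<open>Strict monoidal categories\<close>

text \<open>
  A category is given by its sets of objects and of morphisms; every morphism carries its
  domain and codomain.  Outside these carriers the operations are unconstrained.
\<close>

record ('o, 'm) strict_monoidal =
  Obj :: "'o set"
  Arr :: "'m set"
  Dom :: "'m \<Rightarrow> 'o"
  Cod :: "'m \<Rightarrow> 'o"
  Ident :: "'o \<Rightarrow> 'm"
  Comp :: "'m \<Rightarrow> 'm \<Rightarrow> 'm"  (infixl "\<cdot>\<index>" 70)
  TensO :: "'o \<Rightarrow> 'o \<Rightarrow> 'o"  (infixl "\<otimes>\<^sub>o\<index>" 75)
  TensM :: "'m \<Rightarrow> 'm \<Rightarrow> 'm"  (infixl "\<otimes>\<^sub>m\<index>" 75)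
  UnitO :: "'o"  ("\<I>\<index>")

definition Mor :: "('o, 'm, 'x) strict_monoidal_scheme \<Rightarrow> 'o \<Rightarrow> 'o \<Rightarrow> 'm set" where
  "Mor C A B = {f \<in> Arr C. Dom C f = A \<and> Cod C f = B}"

locale category =
  fixes C :: "('o, 'm, 'x) strict_monoidal_scheme" (structure)
  assumes Dom_Obj: "f \<in> Arr C \<Longrightarrow> Dom C f \<in> Obj C"
    and Cod_Obj: "f \<in> Arr C \<Longrightarrow> Cod C f \<in> Obj C"
    and Ident_Mor: "A \<in> Obj C \<Longrightarrow> Ident C A \<in> Mor C A A"
    and Comp_Mor: "\<lbrakk>g \<in> Mor C B D; f \<in> Mor C A B\<rbrakk> \<Longrightarrow> g \<cdot> f \<in> Mor C A D"
    and Comp_Ident_left: "f \<in> Mor C A B \<Longrightarrow> Ident C B \<cdot> f = f"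
    and Comp_Ident_right: "f \<in> Mor C A B \<Longrightarrow> f \<cdot> Ident C A = f"
    and Comp_assoc: "\<lbrakk>h \<in> Mor C D E; g \<in> Mor C B D; f \<in> Mor C A B\<rbrakk>
          \<Longrightarrow> h \<cdot> g \<cdot> f = h \<cdot> (g \<cdot> f)"

locale strict_monoidal_category = category C
  for C :: "('o, 'm, 'x) strict_monoidal_scheme" (structure) +
  assumes UnitO_Obj: "\<I> \<in> Obj C"
    and TensO_Obj: "\<lbrakk>A \<in> Obj C; B \<in> Obj C\<rbrakk> \<Longrightarrow> A \<otimes>\<^sub>o B \<in> Obj C"
    and TensO_assoc: "\<lbrakk>A \<in> Obj C; B \<in> Obj C; D \<in> Obj C\<rbrakk>
          \<Longrightarrow> (A \<otimes>\<^sub>o B) \<otimes>\<^sub>o D = A \<otimes>\<^sub>o (B \<otimes>\<^sub>o D)"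
    and TensO_unit_left: "A \<in> Obj C \<Longrightarrow> \<I> \<otimes>\<^sub>o A = A"
    and TensO_unit_right: "A \<in> Obj C \<Longrightarrow> A \<otimes>\<^sub>o \<I> = A"
    and TensM_Mor: "\<lbrakk>f \<in> Mor C A B; g \<in> Mor C A' B'\<rbrakk>
          \<Longrightarrow> f \<otimes>\<^sub>m g \<in> Mor C (A \<otimes>\<^sub>o A') (B \<otimes>\<^sub>o B')"
    and TensM_Ident: "\<lbrakk>A \<in> Obj C; B \<in> Obj C\<rbrakk>
          \<Longrightarrow> Ident C A \<otimes>\<^sub>m Ident C B = Ident C (A \<otimes>\<^sub>o B)"
    and TensM_Comp: "\<lbrakk>g \<in> Mor C B D; f \<in> Mor C A B; g' \<in> Mor C B' D'; f' \<in> Mor C A' B'\<rbrakk>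
          \<Longrightarrow> (g \<cdot> f) \<otimes>\<^sub>m (g' \<cdot> f') = (g \<otimes>\<^sub>m g') \<cdot> (f \<otimes>\<^sub>m f')"
    and TensM_assoc: "\<lbrakk>f \<in> Arr C; g \<in> Arr C; h \<in> Arr C\<rbrakk>
          \<Longrightarrow> (f \<otimes>\<^sub>m g) \<otimes>\<^sub>m h = f \<otimes>\<^sub>m (g \<otimes>\<^sub>m h)"
    and TensM_unit_left: "f \<in> Arr C \<Longrightarrow> Ident C \<I> \<otimes>\<^sub>m f = f"
    and TensM_unit_right: "f \<in> Arr C \<Longrightarrow> f \<otimes>\<^sub>m Ident C \<I> = f"


section \<open>Preadditive and symmetric structures\<close>

record ('o, 'm) preadditive_strict_monoidal = "('o, 'm) strict_monoidal" +
  Plus :: "'m \<Rightarrow> 'm \<Rightarrow> 'm"  (infixl "\<oplus>\<index>" 65)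
  Zero :: "'o \<Rightarrow> 'o \<Rightarrow> 'm"  ("\<zero>\<index>")

definition Mor_group ::
    "('o, 'm, 'x) preadditive_strict_monoidal_scheme \<Rightarrow> 'o \<Rightarrow> 'o \<Rightarrow> 'm monoid" where
  "Mor_group C A B = \<lparr>carrier = Mor C A B, monoid.mult = Plus C, one = Zero C A B\<rparr>"

definition Minus ::
    "('o, 'm, 'x) preadditive_strict_monoidal_scheme \<Rightarrow> 'm \<Rightarrow> 'm \<Rightarrow> 'm"
    (infixl "\<ominus>\<index>" 65) where
  "f \<ominus>\<^bsub>C\<^esub> g = f \<oplus>\<^bsub>C\<^esub> (inv\<^bsub>Mor_group C (Dom C g) (Cod C g)\<^esub> g)"

locale preadditive_strict_monoidal_category = strict_monoidal_category C
  for C :: "('o, 'm, 'x) preadditive_strict_monoidal_scheme" (structure) +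
  assumes Mor_comm_group: "\<lbrakk>A \<in> Obj C; B \<in> Obj C\<rbrakk> \<Longrightarrow> comm_group (Mor_group C A B)"
    and Comp_Plus_left: "\<lbrakk>g \<in> Mor C B D; g' \<in> Mor C B D; f \<in> Mor C A B\<rbrakk>
          \<Longrightarrow> (g \<oplus> g') \<cdot> f = g \<cdot> f \<oplus> g' \<cdot> f"
    and Comp_Plus_right: "\<lbrakk>g \<in> Mor C B D; f \<in> Mor C A B; f' \<in> Mor C A B\<rbrakk>
          \<Longrightarrow> g \<cdot> (f \<oplus> f') = g \<cdot> f \<oplus> g \<cdot> f'"
    and TensM_Plus_left: "\<lbrakk>f \<in> Mor C A B; f' \<in> Mor C A B; g \<in> Mor C A' B'\<rbrakk>
          \<Longrightarrow> (f \<oplus> f') \<otimes>\<^sub>m g = f \<otimes>\<^sub>m g \<oplus> f' \<otimes>\<^sub>m g"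
    and TensM_Plus_right: "\<lbrakk>f \<in> Mor C A B; g \<in> Mor C A' B'; g' \<in> Mor C A' B'\<rbrakk>
          \<Longrightarrow> f \<otimes>\<^sub>m (g \<oplus> g') = f \<otimes>\<^sub>m g \<oplus> f \<otimes>\<^sub>m g'"

locale symmetric_strict_monoidal_category = strict_monoidal_category C
  for C :: "('o, 'm, 'x) strict_monoidal_scheme" (structure)
    and c :: "'o \<Rightarrow> 'o \<Rightarrow> 'm" +
  assumes c_Mor: "\<lbrakk>A \<in> Obj C; B \<in> Obj C\<rbrakk> \<Longrightarrow> c A B \<in> Mor C (A \<otimes>\<^sub>o B) (B \<otimes>\<^sub>o A)"
    and c_natural: "\<lbrakk>f \<in> Mor C A B; g \<in> Mor C A' B'\<rbrakk>
          \<Longrightarrow> c B B' \<cdot> (f \<otimes>\<^sub>m g) = (g \<otimes>\<^sub>m f) \<cdot> c A A'"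
    and c_TensO_right: "\<lbrakk>A \<in> Obj C; B \<in> Obj C; D \<in> Obj C\<rbrakk>
          \<Longrightarrow> c A (B \<otimes>\<^sub>o D) = (Ident C B \<otimes>\<^sub>m c A D) \<cdot> (c A B \<otimes>\<^sub>m Ident C D)"
    and c_TensO_left: "\<lbrakk>A \<in> Obj C; B \<in> Obj C; D \<in> Obj C\<rbrakk>
          \<Longrightarrow> c (A \<otimes>\<^sub>o B) D = (c A D \<otimes>\<^sub>m Ident C B) \<cdot> (Ident C A \<otimes>\<^sub>m c B D)"
    and c_symmetric: "\<lbrakk>A \<in> Obj C; B \<in> Obj C\<rbrakk>
          \<Longrightarrow> c B A \<cdot> c A B = Ident C (A \<otimes>\<^sub>o B)"

locale symmetric_preadditive_strict_monoidal_category =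
  preadditive_strict_monoidal_category C + symmetric_strict_monoidal_category C c
  for C :: "('o, 'm, 'x) preadditive_strict_monoidal_scheme" (structure)
    and c :: "'o \<Rightarrow> 'o \<Rightarrow> 'm"


section \<open>Braided objects\<close>

definition pre_braiding ::
    "('o, 'm, 'x) strict_monoidal_scheme \<Rightarrow> 'o \<Rightarrow> 'm \<Rightarrow> bool" where
  "pre_braiding C V \<sigma> \<longleftrightarrow>
     \<sigma> \<in> Mor C (V \<otimes>\<^sub>o\<^bsub>C\<^esub> V) (V \<otimes>\<^sub>o\<^bsub>C\<^esub> V) \<and>
     (\<sigma> \<otimes>\<^sub>m\<^bsub>C\<^esub> Ident C V) \<cdot>\<^bsub>C\<^esub> (Ident C V \<otimes>\<^sub>m\<^bsub>C\<^esub> \<sigma>) \<cdot>\<^bsub>C\<^esub> (\<sigma> \<otimes>\<^sub>m\<^bsub>C\<^esub> Ident C V) =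
     (Ident C V \<otimes>\<^sub>m\<^bsub>C\<^esub> \<sigma>) \<cdot>\<^bsub>C\<^esub> (\<sigma> \<otimes>\<^sub>m\<^bsub>C\<^esub> Ident C V) \<cdot>\<^bsub>C\<^esub> (Ident C V \<otimes>\<^sub>m\<^bsub>C\<^esub> \<sigma>)"

definition invertible ::
    "('o, 'm, 'x) strict_monoidal_scheme \<Rightarrow> 'o \<Rightarrow> 'o \<Rightarrow> 'm \<Rightarrow> bool" where
  "invertible C A B f \<longleftrightarrow> f \<in> Mor C A B \<and>
     (\<exists>g \<in> Mor C B A. g \<cdot>\<^bsub>C\<^esub> f = Ident C A \<and> f \<cdot>\<^bsub>C\<^esub> g = Ident C B)"

definition braiding ::
    "('o, 'm, 'x) strict_monoidal_scheme \<Rightarrow> 'o \<Rightarrow> 'm \<Rightarrow> bool" where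
  "braiding C V \<sigma> \<longleftrightarrow>
     pre_braiding C V \<sigma> \<and> invertible C (V \<otimes>\<^sub>o\<^bsub>C\<^esub> V) (V \<otimes>\<^sub>o\<^bsub>C\<^esub> V) \<sigma>"


section \<open>Associative and Leibniz structures\<close>

definition two_sided_unit ::
    "('o, 'm, 'x) strict_monoidal_scheme \<Rightarrow> 'o \<Rightarrow> 'm \<Rightarrow> 'm \<Rightarrow> bool" where
  "two_sided_unit C V \<mu> \<nu> \<longleftrightarrow>
     \<mu> \<cdot>\<^bsub>C\<^esub> (Ident C V \<otimes>\<^sub>m\<^bsub>C\<^esub> \<nu>) = Ident C V \<and> \<mu> \<cdot>\<^bsub>C\<^esub> (\<nu> \<otimes>\<^sub>m\<^bsub>C\<^esub> Ident C V) = Ident C V"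

definition associative ::
    "('o, 'm, 'x) strict_monoidal_scheme \<Rightarrow> 'o \<Rightarrow> 'm \<Rightarrow> bool" where
  "associative C V \<mu> \<longleftrightarrow>
     \<mu> \<cdot>\<^bsub>C\<^esub> (Ident C V \<otimes>\<^sub>m\<^bsub>C\<^esub> \<mu>) = \<mu> \<cdot>\<^bsub>C\<^esub> (\<mu> \<otimes>\<^sub>m\<^bsub>C\<^esub> Ident C V)"

definition sigma_Ass ::
    "('o, 'm, 'x) strict_monoidal_scheme \<Rightarrow> 'm \<Rightarrow> 'm \<Rightarrow> 'm" where
  "sigma_Ass C \<mu> \<nu> = \<nu> \<otimes>\<^sub>m\<^bsub>C\<^esub> \<mu>"

definition Lie_unit ::
    "('o, 'm, 'x) preadditive_strict_monoidal_scheme \<Rightarrow> 'o \<Rightarrow> 'm \<Rightarrow> 'm \<Rightarrow> bool" where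
  "Lie_unit C V br \<nu> \<longleftrightarrow>
     br \<cdot>\<^bsub>C\<^esub> (Ident C V \<otimes>\<^sub>m\<^bsub>C\<^esub> \<nu>) = \<zero>\<^bsub>C\<^esub> V V \<and> br \<cdot>\<^bsub>C\<^esub> (\<nu> \<otimes>\<^sub>m\<^bsub>C\<^esub> Ident C V) = \<zero>\<^bsub>C\<^esub> V V"

definition Leibniz ::
    "('o, 'm, 'x) preadditive_strict_monoidal_scheme \<Rightarrow> ('o \<Rightarrow> 'o \<Rightarrow> 'm) \<Rightarrow> 'o \<Rightarrow> 'm \<Rightarrow> bool" where
  "Leibniz C c V br \<longleftrightarrow>
     br \<cdot>\<^bsub>C\<^esub> (Ident C V \<otimes>\<^sub>m\<^bsub>C\<^esub> br) =
     br \<cdot>\<^bsub>C\<^esub> (br \<otimes>\<^sub>m\<^bsub>C\<^esub> Ident C V)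
       \<ominus>\<^bsub>C\<^esub> br \<cdot>\<^bsub>C\<^esub> (br \<otimes>\<^sub>m\<^bsub>C\<^esub> Ident C V) \<cdot>\<^bsub>C\<^esub> (Ident C V \<otimes>\<^sub>m\<^bsub>C\<^esub> c V V)"

definition normalized ::
    "('o, 'm, 'x) strict_monoidal_scheme \<Rightarrow> 'm \<Rightarrow> 'm \<Rightarrow> bool" where
  "normalized C \<nu> \<gamma> \<longleftrightarrow> \<gamma> \<cdot>\<^bsub>C\<^esub> \<nu> = Ident C \<I>\<^bsub>C\<^esub>"

definition sigma_Lei ::
    "('o, 'm, 'x) preadditive_strict_monoidal_scheme \<Rightarrow> ('o \<Rightarrow> 'o \<Rightarrow> 'm) \<Rightarrow> 'o \<Rightarrow> 'm \<Rightarrow> 'm \<Rightarrow> 'm" where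
  "sigma_Lei C c V br \<nu> = c V V \<oplus>\<^bsub>C\<^esub> \<nu> \<otimes>\<^sub>m\<^bsub>C\<^esub> br"

end

theory Submission
  imports Defs
begin

text \<open>
  Both endomorphisms contain a morphism of the form \<open>\<nu> \<otimes> m\<close> with \<open>m : V \<otimes> V \<rightarrow> V\<close>: on
  elements, \<open>(x, y) \<mapsto> (1, xy)\<close>.  Written on elements of \<open>V \<otimes> V \<otimes> V\<close>, the two sides of the
  braid equation for \<open>\<nu> \<otimes> \<mu>\<close> become \<open>(x, y, z) \<mapsto> (1, 1, (xy)z)\<close> and
  \<open>(x, y, z) \<mapsto> (1, 1, x(yz))\<close> as soon as \<open>1\<close> is a unit.  So the braid equation says that
  associativity holds after tensoring with \<open>\<nu> \<otimes> \<nu>\<close>, and \<open>\<nu> \<otimes> -\<close> is injective on morphisms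
  because \<open>\<nu> \<otimes> Id\<^sub>V\<close> has the left inverse \<open>\<mu>\<close>.

  For \<open>c + N\<close> with \<open>N = \<nu> \<otimes> [,]\<close>, let \<open>P\<^sub>1, P\<^sub>2, N\<^sub>1, N\<^sub>2\<close> be \<open>c\<close> and \<open>N\<close> acting on the first
  two and on the last two factors.  Each side of the braid equation is a sum of eight triple
  products.  The products with at least two factors \<open>P\<close> agree in pairs for every endomorphism
  \<open>N\<close> whatsoever, since \<open>P\<^sub>1 P\<^sub>2\<close> and \<open>P\<^sub>2 P\<^sub>1\<close> are themselves symmetries, of \<open>V \<otimes> V\<close> with
  \<open>V\<close>, and so \<open>N\<close> slides through them (\<open>slide_right\<close>, \<open>slide_left\<close>, \<open>slide_middle\<close>).  The
  Lie unit condition gives \<open>N\<^sub>1 N\<^sub>2 = 0\<close> and \<open>N\<^sub>1 P\<^sub>2 N\<^sub>1 = 0\<close>.  What is left is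
  \<open>P\<^sub>1 N\<^sub>2 N\<^sub>1 = N\<^sub>2 P\<^sub>1 N\<^sub>2 + N\<^sub>2 N\<^sub>1 P\<^sub>2\<close>, in elements
  \<open>(1, 1, [[x, y], z]) = (1, 1, [x, [y, z]]) + (1, 1, [[x, z], y])\<close>: the Leibniz condition
  tensored with \<open>\<nu> \<otimes> \<nu>\<close>, which \<open>\<gamma>\<close> removes.  Invertibility is automatic: \<open>N c N = 0\<close>, hence
  \<open>c - c N c\<close> is inverse to \<open>c + N\<close>.
\<close>


section \<open>Calculus of tensor products\<close>

lemma MorD:
  assumes "f \<in> Mor C A B"
  shows "f \<in> Arr C" "Dom C f = A" "Cod C f = B"
  using assms by (auto simp: Mor_def)

lemma MorI: "\<lbrakk>f \<in> Arr C; Dom C f = A; Cod C f = B\<rbrakk> \<Longrightarrow> f \<in> Mor C A B"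
  by (simp add: Mor_def)

context strict_monoidal_category
begin

text \<open>
  The axioms are restated with domains and codomains in place of membership in a set of
  morphisms, so that rewriting can discharge all typing conditions.
\<close>

lemma Obj_simps [simp]:
  "\<I> \<in> Obj C"
  "f \<in> Arr C \<Longrightarrow> Dom C f \<in> Obj C"
  "f \<in> Arr C \<Longrightarrow> Cod C f \<in> Obj C"
  "\<lbrakk>A \<in> Obj C; B \<in> Obj C\<rbrakk> \<Longrightarrow> A \<otimes>\<^sub>o B \<in> Obj C"
  "\<lbrakk>A \<in> Obj C; B \<in> Obj C; E \<in> Obj C\<rbrakk> \<Longrightarrow> (A \<otimes>\<^sub>o B) \<otimes>\<^sub>o E = A \<otimes>\<^sub>o (B \<otimes>\<^sub>o E)"
  "A \<in> Obj C \<Longrightarrow> \<I> \<otimes>\<^sub>o A = A"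
  "A \<in> Obj C \<Longrightarrow> A \<otimes>\<^sub>o \<I> = A"
  by (simp_all add: UnitO_Obj Dom_Obj Cod_Obj TensO_Obj TensO_assoc
      TensO_unit_left TensO_unit_right)

lemma Ident_simps [simp]:
  assumes "A \<in> Obj C"
  shows "Ident C A \<in> Arr C" "Dom C (Ident C A) = A" "Cod C (Ident C A) = A"
  using MorD[OF Ident_Mor[OF assms]] by auto

lemma Comp_simps [simp]:
  assumes "g \<in> Arr C" "f \<in> Arr C" "Dom C g = Cod C f"
  shows "g \<cdot> f \<in> Arr C" "Dom C (g \<cdot> f) = Dom C f" "Cod C (g \<cdot> f) = Cod C g"
  using MorD[OF Comp_Mor[of g "Cod C f" "Cod C g" f "Dom C f"]] assms
  by (auto simp: Mor_def)

lemma TensM_simps [simp]: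
  assumes "f \<in> Arr C" "g \<in> Arr C"
  shows "f \<otimes>\<^sub>m g \<in> Arr C"
    "Dom C (f \<otimes>\<^sub>m g) = Dom C f \<otimes>\<^sub>o Dom C g"
    "Cod C (f \<otimes>\<^sub>m g) = Cod C f \<otimes>\<^sub>o Cod C g"
  using MorD[OF TensM_Mor[of f "Dom C f" "Cod C f" g "Dom C g" "Cod C g"]] assms
  by (auto simp: Mor_def)

lemma Ident_absorb [simp]:
  "\<lbrakk>f \<in> Arr C; B = Cod C f\<rbrakk> \<Longrightarrow> Ident C B \<cdot> f = f"
  "\<lbrakk>f \<in> Arr C; A = Dom C f\<rbrakk> \<Longrightarrow> f \<cdot> Ident C A = f"
  "f \<in> Arr C \<Longrightarrow> Ident C \<I> \<otimes>\<^sub>m f = f"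
  "f \<in> Arr C \<Longrightarrow> f \<otimes>\<^sub>m Ident C \<I> = f"
  "\<lbrakk>A \<in> Obj C; B \<in> Obj C\<rbrakk> \<Longrightarrow> Ident C A \<otimes>\<^sub>m Ident C B = Ident C (A \<otimes>\<^sub>o B)"
  by (auto simp: TensM_unit_left TensM_unit_right TensM_Ident
      intro: Comp_Ident_left Comp_Ident_right MorI)

lemma Comp_Arr_assoc:
  "\<lbrakk>h \<in> Arr C; g \<in> Arr C; f \<in> Arr C; Dom C h = Cod C g; Dom C g = Cod C f\<rbrakk>
    \<Longrightarrow> h \<cdot> g \<cdot> f = h \<cdot> (g \<cdot> f)"
  by (rule Comp_assoc) (auto intro: MorI)

lemma interchange:
  "\<lbrakk>g \<in> Arr C; f \<in> Arr C; g' \<in> Arr C; f' \<in> Arr C; Dom C g = Cod C f; Dom C g' = Cod C f'\<rbrakk>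
    \<Longrightarrow> (g \<otimes>\<^sub>m g') \<cdot> (f \<otimes>\<^sub>m f') = (g \<cdot> f) \<otimes>\<^sub>m (g' \<cdot> f')"
  by (rule TensM_Comp[symmetric]) (auto intro: MorI)

text \<open>A factor with domain \<open>\<I>\<close> takes no part in a composition: interchange with
  \<open>n = n \<cdot> Id\<^sub>I\<close>.\<close>

lemma scalar_tensor_Comp:
  assumes "n \<in> Arr C" "Dom C n = \<I>" "f \<in> Arr C" "g \<in> Arr C" "Dom C f = Cod C g"
  shows "(n \<otimes>\<^sub>m f) \<cdot> g = n \<otimes>\<^sub>m (f \<cdot> g)"
    and "(f \<otimes>\<^sub>m n) \<cdot> g = (f \<cdot> g) \<otimes>\<^sub>m n"
  using assms interchange[of n "Ident C \<I>" f g] interchange[of f g n "Ident C \<I>"] by auto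

text \<open>Apply \<open>r\<close> to \<open>n \<otimes> f = (n \<otimes> Id\<^sub>V) \<cdot> f\<close>.  Two kinds of retraction \<open>r\<close> matter below: a product
  with left unit \<open>n\<close>, tensored with an identity if need be, and \<open>\<gamma> \<otimes> Id\<^sub>V\<close> for a normalized \<open>\<gamma>\<close>.\<close>

lemma tensor_point_cancel:
  assumes n: "n \<in> Arr C" "Dom C n = \<I>"
    and fg: "f \<in> Arr C" "g \<in> Arr C" "Cod C f = V" "Cod C g = V"
    and r: "r \<in> Arr C" "Dom C r = Cod C n \<otimes>\<^sub>o V" "r \<cdot> (n \<otimes>\<^sub>m Ident C V) = Ident C V"
    and eq: "n \<otimes>\<^sub>m f = n \<otimes>\<^sub>m g"
  shows "f = g"
proof -
  have V: "V \<in> Obj C" using fg Obj_simps(3) by blast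
  have retract: "r \<cdot> (n \<otimes>\<^sub>m h) = h" if h: "h \<in> Arr C" "Cod C h = V" for h
  proof -
    have "n \<otimes>\<^sub>m h = (n \<otimes>\<^sub>m Ident C V) \<cdot> h"
      using n V h by (simp add: scalar_tensor_Comp)
    also have "r \<cdot> \<dots> = r \<cdot> (n \<otimes>\<^sub>m Ident C V) \<cdot> h"
      by (rule Comp_Arr_assoc[symmetric]) (use V n r h in auto)
    finally show ?thesis using r h by simp
  qed
  show ?thesis using retract fg eq by metis
qed

end


section \<open>The endomorphism built from a unit and a product\<close>

locale pointed_product = strict_monoidal_category C
  for C :: "('o, 'm, 'x) strict_monoidal_scheme" (structure) +
  fixes V :: 'o and m n :: 'm
  assumes V [simp]: "V \<in> Obj C"
    and m_Mor: "m \<in> Mor C (V \<otimes>\<^sub>o V) V"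
    and n_Mor: "n \<in> Mor C \<I> V"
begin

lemma mn_simps [simp]:
  "m \<in> Arr C" "Dom C m = V \<otimes>\<^sub>o V" "Cod C m = V"
  "n \<in> Arr C" "Dom C n = \<I>" "Cod C n = V"
  using m_Mor n_Mor by (auto dest: MorD)

abbreviation "i \<equiv> Ident C V"

text \<open>On elements: \<open>(x, y, z) \<mapsto> (1, xy, z) \<mapsto> (1, 1, (xy)z)\<close>.\<close>

lemma insert_right_after_left:
  "(i \<otimes>\<^sub>m (n \<otimes>\<^sub>m m)) \<cdot> ((n \<otimes>\<^sub>m m) \<otimes>\<^sub>m i) = n \<otimes>\<^sub>m (n \<otimes>\<^sub>m (m \<cdot> (m \<otimes>\<^sub>m i)))"
  by (simp add: TensM_assoc interchange scalar_tensor_Comp)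

text \<open>On elements: \<open>(x, y, z) \<mapsto> (x, 1, yz) \<mapsto> (1, x1, yz)\<close>.\<close>

lemma insert_left_after_right:
  "((n \<otimes>\<^sub>m m) \<otimes>\<^sub>m i) \<cdot> (i \<otimes>\<^sub>m (n \<otimes>\<^sub>m m)) = n \<otimes>\<^sub>m ((m \<cdot> (i \<otimes>\<^sub>m n)) \<otimes>\<^sub>m m)"
proof -
  have "((n \<otimes>\<^sub>m m) \<otimes>\<^sub>m i) \<cdot> (i \<otimes>\<^sub>m (n \<otimes>\<^sub>m m)) = n \<otimes>\<^sub>m ((m \<otimes>\<^sub>m i) \<cdot> (i \<otimes>\<^sub>m (n \<otimes>\<^sub>m m)))"
    by (simp add: TensM_assoc scalar_tensor_Comp)
  also have "(m \<otimes>\<^sub>m i) \<cdot> (i \<otimes>\<^sub>m (n \<otimes>\<^sub>m m)) = (m \<cdot> (i \<otimes>\<^sub>m n)) \<otimes>\<^sub>m m"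
    using interchange[of m "i \<otimes>\<^sub>m n" i m] by (simp add: TensM_assoc)
  finally show ?thesis .
qed

text \<open>On elements: \<open>(x, y, z) \<mapsto> (1, x, yz) \<mapsto> (1, 1, x(yz))\<close>.\<close>

lemma insert_right_after_point:
  "(i \<otimes>\<^sub>m (n \<otimes>\<^sub>m m)) \<cdot> (n \<otimes>\<^sub>m (i \<otimes>\<^sub>m m)) = n \<otimes>\<^sub>m (n \<otimes>\<^sub>m (m \<cdot> (i \<otimes>\<^sub>m m)))"
  by (simp add: interchange scalar_tensor_Comp)

lemma pre_braiding_sigma_Ass_iff:
  assumes u: "two_sided_unit C V m n"
  shows "pre_braiding C V (sigma_Ass C m n) \<longleftrightarrow> associative C V m"
proof -
  have ur: "m \<cdot> (i \<otimes>\<^sub>m n) = i" and ul: "m \<cdot> (n \<otimes>\<^sub>m i) = i"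
    using u by (auto simp: two_sided_unit_def)
  let ?s1 = "(n \<otimes>\<^sub>m m) \<otimes>\<^sub>m i" and ?s2 = "i \<otimes>\<^sub>m (n \<otimes>\<^sub>m m)"
  let ?L = "m \<cdot> (m \<otimes>\<^sub>m i)" and ?R = "m \<cdot> (i \<otimes>\<^sub>m m)"
  have s12: "?s1 \<cdot> ?s2 = n \<otimes>\<^sub>m (i \<otimes>\<^sub>m m)"
    using insert_left_after_right by (simp add: ur)
  have rhs: "?s2 \<cdot> ?s1 \<cdot> ?s2 = n \<otimes>\<^sub>m (n \<otimes>\<^sub>m ?R)"
    by (simp add: Comp_Arr_assoc s12 insert_right_after_point)
  have "?s1 \<cdot> ?s2 \<cdot> ?s1 = (n \<otimes>\<^sub>m (i \<otimes>\<^sub>m m)) \<cdot> ((n \<otimes>\<^sub>m m) \<otimes>\<^sub>m i)"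
    by (simp add: s12)
  also have "\<dots> = n \<otimes>\<^sub>m ((i \<otimes>\<^sub>m m) \<cdot> (n \<otimes>\<^sub>m (m \<otimes>\<^sub>m i)))"
    by (simp add: scalar_tensor_Comp TensM_assoc)
  also have "\<dots> = n \<otimes>\<^sub>m (n \<otimes>\<^sub>m ?L)"
    by (simp add: interchange)
  finally have lhs: "?s1 \<cdot> ?s2 \<cdot> ?s1 = n \<otimes>\<^sub>m (n \<otimes>\<^sub>m ?L)" .
  have cancel: "f = g" if "f \<in> Arr C" "g \<in> Arr C" "Cod C f = V" "Cod C g = V"
    "n \<otimes>\<^sub>m (n \<otimes>\<^sub>m f) = n \<otimes>\<^sub>m (n \<otimes>\<^sub>m g)" for f g
  proof -
    have 1: "(m \<otimes>\<^sub>m i) \<cdot> (n \<otimes>\<^sub>m Ident C (V \<otimes>\<^sub>o V)) = Ident C (V \<otimes>\<^sub>o V)"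
      using interchange[of m "n \<otimes>\<^sub>m i" i i] by (simp add: ul TensM_assoc)
    have "n \<otimes>\<^sub>m f = n \<otimes>\<^sub>m g"
      by (rule tensor_point_cancel[where n = n and V = "V \<otimes>\<^sub>o V" and r = "m \<otimes>\<^sub>m i"])
        (use that 1 in auto)
    then show ?thesis
      using tensor_point_cancel[where n = n and V = V and r = m] that ul by auto
  qed
  have "?L = ?R" if "n \<otimes>\<^sub>m (n \<otimes>\<^sub>m ?L) = n \<otimes>\<^sub>m (n \<otimes>\<^sub>m ?R)"
    by (rule cancel) (use that in auto)
  then show ?thesis
    unfolding pre_braiding_def associative_def sigma_Ass_def lhs rhs
    by (auto intro: MorI)
qed

end


section \<open>Arithmetic in a preadditive category\<close>

context preadditive_strict_monoidal_category
begin

lemma Plus_simps [simp]: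
  assumes "f \<in> Arr C" "g \<in> Arr C" "Dom C f = Dom C g" "Cod C f = Cod C g"
  shows "f \<oplus> g \<in> Arr C" "Dom C (f \<oplus> g) = Dom C g" "Cod C (f \<oplus> g) = Cod C g"
proof -
  interpret G: comm_group "Mor_group C (Dom C g) (Cod C g)"
    using assms by (intro Mor_comm_group) auto
  have "f \<oplus> g \<in> Mor C (Dom C g) (Cod C g)"
    using G.m_closed[of f g] assms by (simp add: Mor_group_def Mor_def)
  then show "f \<oplus> g \<in> Arr C" "Dom C (f \<oplus> g) = Dom C g" "Cod C (f \<oplus> g) = Cod C g"
    by (auto simp: Mor_def)
qed

lemma Zero_simps [simp]:
  assumes "A \<in> Obj C" "B \<in> Obj C"
  shows "\<zero> A B \<in> Arr C" "Dom C (\<zero> A B) = A" "Cod C (\<zero> A B) = B"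
proof -
  interpret G: comm_group "Mor_group C A B"
    using assms by (rule Mor_comm_group)
  show "\<zero> A B \<in> Arr C" "Dom C (\<zero> A B) = A" "Cod C (\<zero> A B) = B"
    using G.one_closed by (auto simp: Mor_group_def Mor_def)
qed

lemma Plus_rules:
  assumes "f \<in> Arr C" "Dom C f = A" "Cod C f = B"
    and "g \<in> Arr C" "Dom C g = A" "Cod C g = B"
    and "h \<in> Arr C" "Dom C h = A" "Cod C h = B"
  shows Plus_assoc: "f \<oplus> g \<oplus> h = f \<oplus> (g \<oplus> h)"
    and Plus_comm: "f \<oplus> g = g \<oplus> f"
    and Plus_left_cancel: "f \<oplus> g = f \<oplus> h \<longleftrightarrow> g = h"
    and Plus_Zero: "f \<oplus> \<zero> A B = f" "\<zero> A B \<oplus> f = f"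
proof -
  interpret G: comm_group "Mor_group C A B"
    using assms by (intro Mor_comm_group) auto
  have "f \<in> carrier (Mor_group C A B)" "g \<in> carrier (Mor_group C A B)"
    "h \<in> carrier (Mor_group C A B)"
    using assms by (auto simp: Mor_group_def Mor_def)
  then show "f \<oplus> g \<oplus> h = f \<oplus> (g \<oplus> h)" "f \<oplus> g = g \<oplus> f"
    "f \<oplus> g = f \<oplus> h \<longleftrightarrow> g = h" "f \<oplus> \<zero> A B = f" "\<zero> A B \<oplus> f = f"
    using G.m_assoc[of f g h] G.m_comm[of f g] G.Units_l_cancel[of f g h, unfolded G.Units_eq]
      G.r_one[of f] G.l_one[of f]
    by (auto simp: Mor_group_def)
qed

lemma negative_exists:
  assumes "f \<in> Arr C" "Dom C f = A" "Cod C f = B"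
  obtains g where "g \<in> Arr C" "Dom C g = A" "Cod C g = B" "f \<oplus> g = \<zero> A B"
proof -
  interpret G: comm_group "Mor_group C A B"
    using assms by (intro Mor_comm_group) auto
  have "f \<in> carrier (Mor_group C A B)"
    using assms by (auto simp: Mor_group_def Mor_def)
  then show ?thesis
    using G.r_inv[of f] G.inv_closed[of f] that[of "inv\<^bsub>Mor_group C A B\<^esub> f"]
    by (auto simp: Mor_group_def Mor_def)
qed

lemma eq_Minus_iff:
  assumes "f \<in> Arr C" "Dom C f = A" "Cod C f = B"
    and "g \<in> Arr C" "Dom C g = A" "Cod C g = B"
    and "h \<in> Arr C" "Dom C h = A" "Cod C h = B"
  shows "f = g \<ominus> h \<longleftrightarrow> g = f \<oplus> h"
proof -
  interpret G: comm_group "Mor_group C A B"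
    using assms by (intro Mor_comm_group) auto
  have "f \<in> carrier (Mor_group C A B)" "g \<in> carrier (Mor_group C A B)"
    "h \<in> carrier (Mor_group C A B)"
    using assms by (auto simp: Mor_group_def Mor_def)
  then show ?thesis
    using G.inv_solve_right[of f g h] assms
    by (auto simp: Mor_group_def Minus_def)
qed

lemma Plus_distribs:
  "\<lbrakk>g \<in> Arr C; g' \<in> Arr C; f \<in> Arr C; Dom C g' = Dom C g; Cod C g' = Cod C g; Dom C g = Cod C f\<rbrakk>
    \<Longrightarrow> (g \<oplus> g') \<cdot> f = g \<cdot> f \<oplus> g' \<cdot> f"
  "\<lbrakk>g \<in> Arr C; f' \<in> Arr C; f \<in> Arr C; Dom C f' = Dom C f; Cod C f' = Cod C f; Dom C g = Cod C f\<rbrakk>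
    \<Longrightarrow> g \<cdot> (f \<oplus> f') = g \<cdot> f \<oplus> g \<cdot> f'"
  "\<lbrakk>g \<in> Arr C; f' \<in> Arr C; f \<in> Arr C; Dom C f' = Dom C f; Cod C f' = Cod C f\<rbrakk>
    \<Longrightarrow> (f \<oplus> f') \<otimes>\<^sub>m g = f \<otimes>\<^sub>m g \<oplus> f' \<otimes>\<^sub>m g"
  "\<lbrakk>g \<in> Arr C; f' \<in> Arr C; f \<in> Arr C; Dom C f' = Dom C f; Cod C f' = Cod C f\<rbrakk>
    \<Longrightarrow> g \<otimes>\<^sub>m (f \<oplus> f') = g \<otimes>\<^sub>m f \<oplus> g \<otimes>\<^sub>m f'"
  by (rule Comp_Plus_left Comp_Plus_right TensM_Plus_left TensM_Plus_right;
      auto simp: Mor_def)+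

lemma idempotent_Plus_eq_Zero:
  assumes "f \<in> Arr C" "Dom C f = A" "Cod C f = B" "f \<oplus> f = f"
  shows "f = \<zero> A B"
proof -
  have AB: "A \<in> Obj C" "B \<in> Obj C" using assms by auto
  have "f \<oplus> f = f \<oplus> \<zero> A B"
    using assms AB Plus_Zero(1)[of f A B f f] by auto
  then show ?thesis
    using Plus_left_cancel[of f A B f "\<zero> A B"] assms AB by auto
qed

lemma Zero_absorb [simp]:
  assumes "A \<in> Obj C" "B \<in> Obj C" "f \<in> Arr C"
  shows "Dom C f = B \<Longrightarrow> f \<cdot> \<zero> A B = \<zero> A (Cod C f)"
    and "Cod C f = A \<Longrightarrow> \<zero> A B \<cdot> f = \<zero> (Dom C f) B"
    and "f \<otimes>\<^sub>m \<zero> A B = \<zero> (Dom C f \<otimes>\<^sub>o A) (Cod C f \<otimes>\<^sub>o B)"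
    and "\<zero> A B \<otimes>\<^sub>m f = \<zero> (A \<otimes>\<^sub>o Dom C f) (B \<otimes>\<^sub>o Cod C f)"
proof -
  have z: "\<zero> A B \<oplus> \<zero> A B = \<zero> A B"
    using Plus_Zero(1)[of "\<zero> A B" A B "\<zero> A B" "\<zero> A B"] assms by auto
  show "Dom C f = B \<Longrightarrow> f \<cdot> \<zero> A B = \<zero> A (Cod C f)"
    by (rule idempotent_Plus_eq_Zero) (use assms z Plus_distribs(2)[of f "\<zero> A B" "\<zero> A B"] in auto)
  show "Cod C f = A \<Longrightarrow> \<zero> A B \<cdot> f = \<zero> (Dom C f) B"
    by (rule idempotent_Plus_eq_Zero) (use assms z Plus_distribs(1)[of "\<zero> A B" "\<zero> A B" f] in auto)
  show "f \<otimes>\<^sub>m \<zero> A B = \<zero> (Dom C f \<otimes>\<^sub>o A) (Cod C f \<otimes>\<^sub>o B)"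
    by (rule idempotent_Plus_eq_Zero) (use assms z Plus_distribs(4)[of f "\<zero> A B" "\<zero> A B"] in auto)
  show "\<zero> A B \<otimes>\<^sub>m f = \<zero> (A \<otimes>\<^sub>o Dom C f) (B \<otimes>\<^sub>o Cod C f)"
    by (rule idempotent_Plus_eq_Zero) (use assms z Plus_distribs(3)[of f "\<zero> A B" "\<zero> A B"] in auto)
qed

end


section \<open>Sliding an endomorphism through the symmetry\<close>

context symmetric_strict_monoidal_category
begin

lemma c_simps [simp]:
  assumes "A \<in> Obj C" "B \<in> Obj C"
  shows "c A B \<in> Arr C" "Dom C (c A B) = A \<otimes>\<^sub>o B" "Cod C (c A B) = B \<otimes>\<^sub>o A"
  using MorD[OF c_Mor[OF assms]] by auto

text \<open>The hexagon for \<open>A \<otimes> (\<I> \<otimes> \<I>)\<close> makes \<open>c A \<I>\<close> idempotent, and it is invertible.\<close>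

lemma c_unit:
  assumes A: "A \<in> Obj C"
  shows "c A \<I> = Ident C A" "c \<I> A = Ident C A"
proof -
  have idem: "c A \<I> \<cdot> c A \<I> = c A \<I>"
    using c_TensO_right[of A \<I> \<I>] A by simp
  have inv: "c \<I> A \<cdot> c A \<I> = Ident C A"
    using c_symmetric[of A \<I>] A by simp
  have "c A \<I> = (c \<I> A \<cdot> c A \<I>) \<cdot> c A \<I>" using A inv by simp
  also have "\<dots> = c \<I> A \<cdot> c A \<I>" using A idem by (simp add: Comp_Arr_assoc)
  finally show 1: "c A \<I> = Ident C A" using inv by simp
  show "c \<I> A = Ident C A" using inv A unfolding 1 by simp
qed

context
  fixes V
  assumes V [simp]: "V \<in> Obj C"
begin

abbreviation "P1 \<equiv> c V V \<otimes>\<^sub>m Ident C V"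
abbreviation "P2 \<equiv> Ident C V \<otimes>\<^sub>m c V V"

lemma P_involutive:
  "P1 \<cdot> P1 = Ident C (V \<otimes>\<^sub>o (V \<otimes>\<^sub>o V))" "P2 \<cdot> P2 = Ident C (V \<otimes>\<^sub>o (V \<otimes>\<^sub>o V))"
  by (simp_all add: interchange c_symmetric)

lemma P_cancel:
  assumes "f \<in> Arr C" "Cod C f = V \<otimes>\<^sub>o (V \<otimes>\<^sub>o V)"
  shows "P1 \<cdot> (P1 \<cdot> f) = f" "P2 \<cdot> (P2 \<cdot> f) = f"
  using assms Comp_Arr_assoc[of P1 P1 f] Comp_Arr_assoc[of P2 P2 f] P_involutive by auto

context
  fixes N
  assumes N [simp]: "N \<in> Arr C" "Dom C N = V \<otimes>\<^sub>o V" "Cod C N = V \<otimes>\<^sub>o V"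
begin

abbreviation "N1 \<equiv> N \<otimes>\<^sub>m Ident C V"
abbreviation "N2 \<equiv> Ident C V \<otimes>\<^sub>m N"

text \<open>By the hexagons \<open>P1 \<cdot> P2\<close> is the symmetry of \<open>V \<otimes> V\<close> with \<open>V\<close>, and \<open>P2 \<cdot> P1\<close> that of \<open>V\<close>
  with \<open>V \<otimes> V\<close>; both lemmas are naturality in the factor \<open>V \<otimes> V\<close>.\<close>

lemma slide_right: "P1 \<cdot> P2 \<cdot> N1 = N2 \<cdot> P1 \<cdot> P2"
  using c_natural[of N "V \<otimes>\<^sub>o V" "V \<otimes>\<^sub>o V" "Ident C V" V V]
  by (simp add: c_TensO_left Mor_def Comp_Arr_assoc)

lemma slide_left: "P2 \<cdot> P1 \<cdot> N2 = N1 \<cdot> P2 \<cdot> P1"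
  using c_natural[of "Ident C V" V V N "V \<otimes>\<^sub>o V" "V \<otimes>\<^sub>o V"]
  by (simp add: c_TensO_right Mor_def Comp_Arr_assoc)

text \<open>Conjugate \<open>slide_right\<close>, using that \<open>P1\<close> and \<open>P2\<close> are involutions.\<close>

lemma slide_middle: "P1 \<cdot> N2 \<cdot> P1 = P2 \<cdot> N1 \<cdot> P2"
proof -
  have "P2 \<cdot> N1 \<cdot> P2 = P1 \<cdot> (P1 \<cdot> P2 \<cdot> N1) \<cdot> P2"
    by (simp add: Comp_Arr_assoc P_cancel)
  also have "\<dots> = P1 \<cdot> N2 \<cdot> P1"
    unfolding slide_right by (simp add: Comp_Arr_assoc P_involutive)
  finally show ?thesis by simp
qed

end

text \<open>The case \<open>N = c V V\<close> of \<open>slide_right\<close>.\<close>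

lemma c_braid: "P1 \<cdot> P2 \<cdot> P1 = P2 \<cdot> P1 \<cdot> P2"
  using slide_right[of "c V V"] by simp

end

end

context symmetric_preadditive_strict_monoidal_category
begin

text \<open>
  Expanding the braid equation for \<open>c V V \<oplus> N\<close> gives eight terms on each side.  The term without
  \<open>N\<close> and the three terms linear in \<open>N\<close> cancel by sliding; the two hypotheses kill all others
  except three.
\<close>

lemma pre_braiding_c_Plus_iff:
  fixes V N
  defines "p1 \<equiv> P1 V" and "p2 \<equiv> P2 V" and "n1 \<equiv> N1 V N" and "n2 \<equiv> N2 V N"
    and "Z \<equiv> \<zero> (V \<otimes>\<^sub>o (V \<otimes>\<^sub>o V)) (V \<otimes>\<^sub>o (V \<otimes>\<^sub>o V))"
  assumes V [simp]: "V \<in> Obj C"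
    and N [simp]: "N \<in> Arr C" "Dom C N = V \<otimes>\<^sub>o V" "Cod C N = V \<otimes>\<^sub>o V"
    and n1n2: "n1 \<cdot> n2 = Z"
    and n1p2n1: "n1 \<cdot> p2 \<cdot> n1 = Z"
  shows "pre_braiding C V (c V V \<oplus> N) \<longleftrightarrow>
    p1 \<cdot> n2 \<cdot> n1 = n2 \<cdot> p1 \<cdot> n2 \<oplus> n2 \<cdot> n1 \<cdot> p2"
proof -
  let ?W = "V \<otimes>\<^sub>o (V \<otimes>\<^sub>o V)"
  \<comment> \<open>All morphisms below lie in the endomorphism ring \<open>E\<close> of \<open>V \<otimes> V \<otimes> V\<close>, where the ring laws
    hold under plain membership conditions.\<close>
  define E where "E = {f \<in> Arr C. Dom C f = ?W \<and> Cod C f = ?W}"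
  have E: "p1 \<in> E" "p2 \<in> E" "n1 \<in> E" "n2 \<in> E" "Z \<in> E"
    by (auto simp: E_def p1_def p2_def n1_def n2_def Z_def)
  have cE: "f \<cdot> g \<in> E" and pE: "f \<oplus> g \<in> E" if "f \<in> E" "g \<in> E" for f g
    using that by (auto simp: E_def)
  have ca: "f \<cdot> g \<cdot> h = f \<cdot> (g \<cdot> h)" if "f \<in> E" "g \<in> E" "h \<in> E" for f g h
    using that by (auto simp: E_def Comp_Arr_assoc)
  have dl: "(f \<oplus> g) \<cdot> h = f \<cdot> h \<oplus> g \<cdot> h" and dr: "h \<cdot> (f \<oplus> g) = h \<cdot> f \<oplus> h \<cdot> g"
    if "f \<in> E" "g \<in> E" "h \<in> E" for f g h
    using that by (auto simp: E_def Plus_distribs)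
  have pa: "f \<oplus> g \<oplus> h = f \<oplus> (g \<oplus> h)" and canc: "f \<oplus> g = f \<oplus> h \<longleftrightarrow> g = h"
    and z: "f \<oplus> Z = f" "Z \<oplus> f = f"
    if "f \<in> E" "g \<in> E" "h \<in> E" for f g h
    using that Plus_rules[of f ?W ?W g h] by (auto simp: E_def Z_def)
  have pc: "f \<oplus> g = g \<oplus> f" if "f \<in> E" "g \<in> E" for f g
    using that Plus_comm[of f ?W ?W g f] by (auto simp: E_def)
  have z': "f \<cdot> Z = Z" "Z \<cdot> f = Z" "f \<oplus> Z = f" "Z \<oplus> f = f" if "f \<in> E" for f
    using that z[OF that that that] by (auto simp: E_def Z_def)
  have lc: "f \<oplus> (g \<oplus> h) = g \<oplus> (f \<oplus> h)" if "f \<in> E" "g \<in> E" "h \<in> E" for f g h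
    using that pa[of f g h] pa[of g f h] pc[of f g] by auto
  have s1: "(c V V \<oplus> N) \<otimes>\<^sub>m Ident C V = p1 \<oplus> n1"
    and s2: "Ident C V \<otimes>\<^sub>m (c V V \<oplus> N) = p2 \<oplus> n2"
    by (auto simp: p1_def p2_def n1_def n2_def Plus_distribs)
  have n1n2': "n1 \<cdot> (n2 \<cdot> f) = Z" if "f \<in> E" for f
    using ca[of n1 n2 f] n1n2 that E z' by auto
  have sl: "p1 \<cdot> (p2 \<cdot> p1) = p2 \<cdot> (p1 \<cdot> p2)" "p1 \<cdot> (p2 \<cdot> n1) = n2 \<cdot> (p1 \<cdot> p2)"
    "n1 \<cdot> (p2 \<cdot> p1) = p2 \<cdot> (p1 \<cdot> n2)" "p1 \<cdot> (n2 \<cdot> p1) = p2 \<cdot> (n1 \<cdot> p2)"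
    using c_braid[OF V] slide_right[OF V N] slide_left[OF V N] slide_middle[OF V N] E ca
    unfolding p1_def[symmetric] p2_def[symmetric] n1_def[symmetric] n2_def[symmetric]
    by auto
  let ?S = "p2 \<cdot> (p1 \<cdot> p2) \<oplus> (n2 \<cdot> (p1 \<cdot> p2) \<oplus> (p2 \<cdot> (p1 \<cdot> n2) \<oplus> p2 \<cdot> (n1 \<cdot> p2)))"
  have k: "n1 \<cdot> (p2 \<cdot> n1) = Z" using n1p2n1 E ca by auto
  have L: "(p1 \<oplus> n1) \<cdot> (p2 \<oplus> n2) \<cdot> (p1 \<oplus> n1) = ?S \<oplus> p1 \<cdot> (n2 \<cdot> n1)"
    by (simp add: E cE pE ca dl dr sl n1n2 n1n2' k z' pa pc lc)
  have R: "(p2 \<oplus> n2) \<cdot> (p1 \<oplus> n1) \<cdot> (p2 \<oplus> n2)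
      = ?S \<oplus> (n2 \<cdot> (p1 \<cdot> n2) \<oplus> n2 \<cdot> (n1 \<cdot> p2))"
    by (simp add: E cE pE ca dl dr sl n1n2 n1n2' k z' pa pc lc)
  have "?S \<oplus> p1 \<cdot> (n2 \<cdot> n1) = ?S \<oplus> (n2 \<cdot> (p1 \<cdot> n2) \<oplus> n2 \<cdot> (n1 \<cdot> p2))
    \<longleftrightarrow> p1 \<cdot> (n2 \<cdot> n1) = n2 \<cdot> (p1 \<cdot> n2) \<oplus> n2 \<cdot> (n1 \<cdot> p2)"
    by (rule canc) (auto intro!: E cE pE)
  then show ?thesis
    unfolding pre_braiding_def s1 s2 L R using E ca by (auto simp: Mor_def)
qed

text \<open>
  Formally \<open>(c + N)\<inverse> = c (1 + N c)\<inverse> = c - c N c + c N c N c - \<dots>\<close>, because \<open>c\<close> is an involution;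
  the hypothesis cuts the series after two terms.
\<close>

lemma invertible_c_Plus:
  assumes V [simp]: "V \<in> Obj C"
    and N [simp]: "N \<in> Arr C" "Dom C N = V \<otimes>\<^sub>o V" "Cod C N = V \<otimes>\<^sub>o V"
    and NcN: "N \<cdot> c V V \<cdot> N = \<zero> (V \<otimes>\<^sub>o V) (V \<otimes>\<^sub>o V)"
  shows "invertible C (V \<otimes>\<^sub>o V) (V \<otimes>\<^sub>o V) (c V V \<oplus> N)"
proof -
  let ?U = "V \<otimes>\<^sub>o V" and ?t = "c V V"
  let ?Z = "\<zero> ?U ?U"
  obtain M where M [simp]: "M \<in> Arr C" "Dom C M = ?U" "Cod C M = ?U" and NM: "N \<oplus> M = ?Z"
    using negative_exists[of N ?U ?U] by auto
  \<comment> \<open>\<open>M\<close> is \<open>- N\<close>, so \<open>X\<close> is \<open>- c N c\<close>.\<close>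
  define X where "X = ?t \<cdot> (M \<cdot> ?t)"
  have X [simp]: "X \<in> Arr C" "Dom C X = ?U" "Cod C X = ?U"
    by (auto simp: X_def)
  have tt: "?t \<cdot> ?t = Ident C ?U" by (simp add: c_symmetric)
  have tt': "?t \<cdot> (?t \<cdot> f) = f" if "f \<in> Arr C" "Cod C f = ?U" for f
    using that Comp_Arr_assoc[of ?t ?t f] tt by auto
  have pa: "f \<oplus> g \<oplus> h = f \<oplus> (g \<oplus> h)" and z: "f \<oplus> ?Z = f"
    if "f \<in> Arr C" "Dom C f = ?U" "Cod C f = ?U" "g \<in> Arr C" "Dom C g = ?U" "Cod C g = ?U"
      "h \<in> Arr C" "Dom C h = ?U" "Cod C h = ?U" for f g h
    using that Plus_rules[of f ?U ?U g h] by auto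
  have zz: "?Z \<oplus> ?Z = ?Z" by (rule z[of ?Z ?Z ?Z]) auto
  have zid: "Ident C ?U \<oplus> ?Z = Ident C ?U" by (rule z[of _ ?Z ?Z]) auto
  have NtM: "N \<cdot> (?t \<cdot> M) = ?Z"
  proof -
    have "N \<cdot> (?t \<cdot> (N \<oplus> M)) = N \<cdot> (?t \<cdot> N) \<oplus> N \<cdot> (?t \<cdot> M)"
      by (simp add: Plus_distribs)
    moreover have "N \<cdot> (?t \<cdot> N) = ?Z" using NcN by (simp add: Comp_Arr_assoc)
    ultimately show ?thesis
      using NM Plus_Zero(2)[of "N \<cdot> (?t \<cdot> M)" ?U ?U "?Z" "?Z"] by simp
  qed
  have MtN: "M \<cdot> (?t \<cdot> N) = ?Z"
  proof -
    have "(N \<oplus> M) \<cdot> (?t \<cdot> N) = N \<cdot> (?t \<cdot> N) \<oplus> M \<cdot> (?t \<cdot> N)"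
      by (simp add: Plus_distribs)
    moreover have "N \<cdot> (?t \<cdot> N) = ?Z" using NcN by (simp add: Comp_Arr_assoc)
    ultimately show ?thesis
      using NM Plus_Zero(2)[of "M \<cdot> (?t \<cdot> N)" ?U ?U "?Z" "?Z"] by simp
  qed
  have tX: "?t \<cdot> X = M \<cdot> ?t" by (simp add: X_def tt')
  have Xt: "X \<cdot> ?t = ?t \<cdot> M" by (simp add: X_def Comp_Arr_assoc tt)
  have NX: "N \<cdot> X = ?Z"
  proof -
    have "N \<cdot> X = (N \<cdot> (?t \<cdot> M)) \<cdot> ?t" by (simp add: X_def Comp_Arr_assoc)
    then show ?thesis unfolding NtM by simp
  qed
  have XN: "X \<cdot> N = ?Z"
  proof -
    have "X \<cdot> N = ?t \<cdot> (M \<cdot> (?t \<cdot> N))" by (simp add: X_def Comp_Arr_assoc)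
    then show ?thesis unfolding MtN by simp
  qed
  have "(?t \<oplus> N) \<cdot> (?t \<oplus> X) = Ident C ?U \<oplus> (N \<cdot> ?t \<oplus> M \<cdot> ?t)"
  proof -
    have "(?t \<oplus> N) \<cdot> (?t \<oplus> X) = (?t \<cdot> ?t \<oplus> N \<cdot> ?t) \<oplus> (?t \<cdot> X \<oplus> N \<cdot> X)"
      by (simp add: Plus_distribs)
    also have "\<dots> = (Ident C ?U \<oplus> N \<cdot> ?t) \<oplus> (M \<cdot> ?t \<oplus> ?Z)"
      by (simp only: tt tX NX)
    also have "M \<cdot> ?t \<oplus> ?Z = M \<cdot> ?t" by (rule z[of _ ?Z ?Z]) auto
    finally show ?thesis by (simp add: pa)
  qed
  also have "N \<cdot> ?t \<oplus> M \<cdot> ?t = (N \<oplus> M) \<cdot> ?t" by (simp add: Plus_distribs)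
  finally have 1: "(?t \<oplus> N) \<cdot> (?t \<oplus> X) = Ident C ?U" unfolding NM by (simp add: zid)
  have "(?t \<oplus> X) \<cdot> (?t \<oplus> N) = Ident C ?U \<oplus> (?t \<cdot> N \<oplus> ?t \<cdot> M)"
  proof -
    have "(?t \<oplus> X) \<cdot> (?t \<oplus> N) = ?t \<cdot> (?t \<oplus> N) \<oplus> X \<cdot> (?t \<oplus> N)"
      by (simp add: Plus_distribs(1))
    also have "\<dots> = (?t \<cdot> ?t \<oplus> ?t \<cdot> N) \<oplus> (X \<cdot> ?t \<oplus> X \<cdot> N)"
      by (simp add: Plus_distribs(2))
    also have "\<dots> = (Ident C ?U \<oplus> ?t \<cdot> N) \<oplus> (?t \<cdot> M \<oplus> ?Z)"
      by (simp only: tt Xt XN)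
    also have "?t \<cdot> M \<oplus> ?Z = ?t \<cdot> M" by (rule z[of _ ?Z ?Z]) auto
    finally show ?thesis by (simp add: pa)
  qed
  also have "?t \<cdot> N \<oplus> ?t \<cdot> M = ?t \<cdot> (N \<oplus> M)" by (simp add: Plus_distribs)
  finally have 2: "(?t \<oplus> X) \<cdot> (?t \<oplus> N) = Ident C ?U" unfolding NM by (simp add: zid)
  show ?thesis
    unfolding invertible_def using 1 2 by (auto simp: Mor_def intro!: exI[of _ "?t \<oplus> X"])
qed

end


section \<open>Brackets with a Lie unit\<close>

locale Lie_pointed_product =
  symmetric_preadditive_strict_monoidal_category C c + pointed_product C V m n
  for C :: "('o, 'm, 'x) preadditive_strict_monoidal_scheme" (structure)
    and c V m n +
  assumes Lie_unit: "Lie_unit C V m n"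
begin

lemma Lie_unit_right: "m \<cdot> (i \<otimes>\<^sub>m n) = \<zero> V V" and Lie_unit_left: "m \<cdot> (n \<otimes>\<^sub>m i) = \<zero> V V"
  using Lie_unit by (auto simp: Lie_unit_def)

abbreviation "N \<equiv> n \<otimes>\<^sub>m m"

lemma c_point:
  shows c_point_left: "c V V \<cdot> (n \<otimes>\<^sub>m i) = i \<otimes>\<^sub>m n"
    and c_point_right: "c V V \<cdot> (i \<otimes>\<^sub>m n) = n \<otimes>\<^sub>m i"
  using c_natural[of n \<I> V i V V] c_natural[of i V V n \<I> V]
  by (simp_all add: Mor_def c_unit)

lemma c_N: "c V V \<cdot> N = m \<otimes>\<^sub>m n"
proof -
  have "N = (n \<otimes>\<^sub>m i) \<cdot> m" by (simp add: scalar_tensor_Comp)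
  then have "c V V \<cdot> N = (c V V \<cdot> (n \<otimes>\<^sub>m i)) \<cdot> m" by (simp add: Comp_Arr_assoc)
  then show ?thesis by (simp add: c_point_left scalar_tensor_Comp)
qed

text \<open>On elements: \<open>(1, [[x, y], 1]) = 0\<close>.\<close>

lemma N_c_N: "N \<cdot> c V V \<cdot> N = \<zero> (V \<otimes>\<^sub>o V) (V \<otimes>\<^sub>o V)"
proof -
  have "m \<otimes>\<^sub>m n = (i \<otimes>\<^sub>m n) \<cdot> m" by (simp add: scalar_tensor_Comp)
  then have "m \<cdot> (m \<otimes>\<^sub>m n) = (m \<cdot> (i \<otimes>\<^sub>m n)) \<cdot> m" by (simp add: Comp_Arr_assoc)
  also have "\<dots> = \<zero> (V \<otimes>\<^sub>o V) V" by (simp add: Lie_unit_right)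
  finally show ?thesis by (simp add: Comp_Arr_assoc c_N scalar_tensor_Comp)
qed

text \<open>On elements: \<open>(1, [x, 1], [y, z]) = 0\<close>.\<close>

lemma N1_N2: "N1 V N \<cdot> N2 V N = \<zero> (V \<otimes>\<^sub>o (V \<otimes>\<^sub>o V)) (V \<otimes>\<^sub>o (V \<otimes>\<^sub>o V))"
  using insert_left_after_right by (simp add: Lie_unit_right)

text \<open>On elements: \<open>(1, [1, z], [x, y]) = 0\<close>.  Sliding first moves the left unit next to the
  bracket that kills it.\<close>

lemma N1_P2_N1: "N1 V N \<cdot> P2 V \<cdot> N1 V N = \<zero> (V \<otimes>\<^sub>o (V \<otimes>\<^sub>o V)) (V \<otimes>\<^sub>o (V \<otimes>\<^sub>o V))"
proof -
  let ?p1 = "P1 V" and ?p2 = "P2 V" and ?n1 = "N1 V N" and ?n2 = "N2 V N"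
  have sl: "?p2 \<cdot> ?p1 \<cdot> ?n2 = ?n1 \<cdot> ?p2 \<cdot> ?p1" by (rule slide_left) auto
  have p1n1: "?p1 \<cdot> ?n1 = m \<otimes>\<^sub>m (n \<otimes>\<^sub>m i)"
    by (simp add: interchange c_N) (simp add: TensM_assoc)
  have kill: "?n2 \<cdot> (m \<otimes>\<^sub>m (n \<otimes>\<^sub>m i)) = \<zero> (V \<otimes>\<^sub>o (V \<otimes>\<^sub>o V)) (V \<otimes>\<^sub>o (V \<otimes>\<^sub>o V))"
    by (simp add: interchange scalar_tensor_Comp Lie_unit_left)
  have "?n1 \<cdot> ?p2 \<cdot> ?n1 = (?n1 \<cdot> ?p2 \<cdot> ?p1) \<cdot> (?p1 \<cdot> ?n1)"
    by (simp only: Comp_Arr_assoc P_cancel Obj_simps Ident_simps Comp_simps TensM_simps c_simps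
        mn_simps V)
  also have "\<dots> = ?p2 \<cdot> (?p1 \<cdot> (?n2 \<cdot> (m \<otimes>\<^sub>m (n \<otimes>\<^sub>m i))))"
    unfolding sl[symmetric] p1n1 by (simp add: Comp_Arr_assoc)
  finally show ?thesis unfolding kill by simp
qed

text \<open>
  The three terms that survive in the braid equation send \<open>(x, y, z)\<close> to \<open>(1, 1, [[x, z], y])\<close>,
  \<open>(1, 1, [[x, y], z])\<close> and \<open>(1, 1, [x, [y, z]])\<close>.  In the last two the symmetry only moves a
  unit and so leaves no trace, by \<open>c_point\<close>; in the first it exchanges \<open>y\<close> and \<open>z\<close>.
\<close>

lemma N2_N1_P2:
  "N2 V N \<cdot> N1 V N \<cdot> P2 V = n \<otimes>\<^sub>m (n \<otimes>\<^sub>m (m \<cdot> (m \<otimes>\<^sub>m i) \<cdot> P2 V))"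
  unfolding insert_right_after_left by (simp add: scalar_tensor_Comp)

lemma P1_N2_N1: "P1 V \<cdot> N2 V N \<cdot> N1 V N = n \<otimes>\<^sub>m (n \<otimes>\<^sub>m (m \<cdot> (m \<otimes>\<^sub>m i)))"
proof -
  let ?L = "m \<cdot> (m \<otimes>\<^sub>m i)"
  have nn: "(i \<otimes>\<^sub>m n) \<cdot> n = n \<otimes>\<^sub>m n" "(n \<otimes>\<^sub>m i) \<cdot> n = n \<otimes>\<^sub>m n"
    by (simp_all add: scalar_tensor_Comp)
  have cnn: "c V V \<cdot> (n \<otimes>\<^sub>m n) = n \<otimes>\<^sub>m n"
    using Comp_Arr_assoc[of "c V V" "n \<otimes>\<^sub>m i" n] by (simp add: nn c_point_left)
  have "P1 V \<cdot> N2 V N \<cdot> N1 V N = P1 V \<cdot> (n \<otimes>\<^sub>m (n \<otimes>\<^sub>m ?L))"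
    by (simp add: Comp_Arr_assoc insert_right_after_left)
  also have "n \<otimes>\<^sub>m (n \<otimes>\<^sub>m ?L) = (n \<otimes>\<^sub>m n) \<otimes>\<^sub>m ?L" by (simp add: TensM_assoc)
  also have "P1 V \<cdot> \<dots> = (c V V \<cdot> (n \<otimes>\<^sub>m n)) \<otimes>\<^sub>m ?L" by (simp add: interchange)
  finally show ?thesis by (simp add: cnn TensM_assoc)
qed

lemma N2_P1_N2: "N2 V N \<cdot> P1 V \<cdot> N2 V N = n \<otimes>\<^sub>m (n \<otimes>\<^sub>m (m \<cdot> (i \<otimes>\<^sub>m m)))"
proof -
  have "N2 V N = (i \<otimes>\<^sub>m n) \<otimes>\<^sub>m m" by (simp add: TensM_assoc)
  then have "P1 V \<cdot> N2 V N = n \<otimes>\<^sub>m (i \<otimes>\<^sub>m m)"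
    by (simp add: interchange c_point_right) (simp add: TensM_assoc)
  then show ?thesis by (simp add: Comp_Arr_assoc insert_right_after_point)
qed

lemma braiding_sigma_Lei_iff:
  assumes g: "g \<in> Mor C V \<I>" "normalized C n g"
  shows "braiding C V (sigma_Lei C c V m n) \<longleftrightarrow> Leibniz C c V m"
proof -
  let ?L = "m \<cdot> (m \<otimes>\<^sub>m i)" and ?R = "m \<cdot> (i \<otimes>\<^sub>m m)" and ?T = "m \<cdot> (m \<otimes>\<^sub>m i) \<cdot> P2 V"
  have g' [simp]: "g \<in> Arr C" "Dom C g = V" "Cod C g = \<I>" and gn: "g \<cdot> n = Ident C \<I>"
    using g by (auto dest: MorD simp: normalized_def)
  have cancel: "f = h" if "f \<in> Arr C" "h \<in> Arr C" "Cod C f = U" "Cod C h = U"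
    "n \<otimes>\<^sub>m f = n \<otimes>\<^sub>m h" for f h U
  proof (rule tensor_point_cancel[where n = n and V = U and r = "g \<otimes>\<^sub>m Ident C U"])
    have U: "U \<in> Obj C" using that by auto
    then show "g \<otimes>\<^sub>m Ident C U \<in> Arr C" "Dom C (g \<otimes>\<^sub>m Ident C U) = Cod C n \<otimes>\<^sub>o U"
      by simp_all
    show "(g \<otimes>\<^sub>m Ident C U) \<cdot> (n \<otimes>\<^sub>m Ident C U) = Ident C U"
      using U by (simp add: interchange gn)
  qed (use that in auto)
  have cancel2: "f = h" if "f \<in> Arr C" "h \<in> Arr C" "Cod C f = V" "Cod C h = V"
    "n \<otimes>\<^sub>m (n \<otimes>\<^sub>m f) = n \<otimes>\<^sub>m (n \<otimes>\<^sub>m h)" for f h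
    using cancel[of "n \<otimes>\<^sub>m f" "n \<otimes>\<^sub>m h" "V \<otimes>\<^sub>o V"] cancel[of f h V] that by simp
  have "pre_braiding C V (c V V \<oplus> N) \<longleftrightarrow>
      n \<otimes>\<^sub>m (n \<otimes>\<^sub>m ?L) = n \<otimes>\<^sub>m (n \<otimes>\<^sub>m ?R) \<oplus> n \<otimes>\<^sub>m (n \<otimes>\<^sub>m ?T)"
    by (subst pre_braiding_c_Plus_iff)
      (auto simp: N1_N2 N1_P2_N1 P1_N2_N1 N2_P1_N2 N2_N1_P2)
  also have "n \<otimes>\<^sub>m (n \<otimes>\<^sub>m ?R) \<oplus> n \<otimes>\<^sub>m (n \<otimes>\<^sub>m ?T) = n \<otimes>\<^sub>m (n \<otimes>\<^sub>m (?R \<oplus> ?T))"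
    by (simp add: Plus_distribs)
  also have "n \<otimes>\<^sub>m (n \<otimes>\<^sub>m ?L) = n \<otimes>\<^sub>m (n \<otimes>\<^sub>m (?R \<oplus> ?T)) \<longleftrightarrow> ?L = ?R \<oplus> ?T"
    using cancel2[of ?L "?R \<oplus> ?T"] by auto
  also have "\<dots> \<longleftrightarrow> ?R = ?L \<ominus> ?T"
    by (rule eq_Minus_iff[symmetric]) auto
  finally have "pre_braiding C V (c V V \<oplus> N) \<longleftrightarrow> Leibniz C c V m"
    by (simp add: Leibniz_def)
  moreover have "invertible C (V \<otimes>\<^sub>o V) (V \<otimes>\<^sub>o V) (c V V \<oplus> N)"
    by (rule invertible_c_Plus) (auto simp: N_c_N)
  ultimately show ?thesis by (simp add: braiding_def sigma_Lei_def)
qed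

end


theorem lemma5p9:
  fixes C :: "('o, 'm, 'x) strict_monoidal_scheme"
    and D :: "('p, 'n, 'y) preadditive_strict_monoidal_scheme"
    and c :: "'p \<Rightarrow> 'p \<Rightarrow> 'n"
  shows
    "(strict_monoidal_category C \<longrightarrow>
       (\<forall>V \<in> Obj C. \<forall>\<mu> \<in> Mor C (V \<otimes>\<^sub>o\<^bsub>C\<^esub> V) V. \<forall>\<nu> \<in> Mor C \<I>\<^bsub>C\<^esub> V.
          two_sided_unit C V \<mu> \<nu> \<longrightarrow>
          (pre_braiding C V (sigma_Ass C \<mu> \<nu>) \<longleftrightarrow> associative C V \<mu>)))
     \<and>
     (symmetric_preadditive_strict_monoidal_category D c \<longrightarrow>
       (\<forall>V \<in> Obj D. \<forall>br \<in> Mor D (V \<otimes>\<^sub>o\<^bsub>D\<^esub> V) V. \<forall>\<nu> \<in> Mor D \<I>\<^bsub>D\<^esub> V.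
          Lie_unit D V br \<nu> \<longrightarrow>
          (\<exists>\<gamma> \<in> Mor D V \<I>\<^bsub>D\<^esub>. normalized D \<nu> \<gamma>) \<longrightarrow>
          (braiding D V (sigma_Lei D c V br \<nu>) \<longleftrightarrow> Leibniz D c V br)))"
proof (intro conjI impI ballI)
  fix V \<mu> \<nu>
  assume C: "strict_monoidal_category C"
    and "V \<in> Obj C" "\<mu> \<in> Mor C (V \<otimes>\<^sub>o\<^bsub>C\<^esub> V) V" "\<nu> \<in> Mor C \<I>\<^bsub>C\<^esub> V"
    and u: "two_sided_unit C V \<mu> \<nu>"
  then interpret pointed_product C V \<mu> \<nu>
    by (simp add: pointed_product_def pointed_product_axioms_def)
  show "pre_braiding C V (sigma_Ass C \<mu> \<nu>) \<longleftrightarrow> associative C V \<mu>"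
    using u by (rule pre_braiding_sigma_Ass_iff)
next
  fix V br \<nu>
  assume D: "symmetric_preadditive_strict_monoidal_category D c"
    and typing: "V \<in> Obj D" "br \<in> Mor D (V \<otimes>\<^sub>o\<^bsub>D\<^esub> V) V" "\<nu> \<in> Mor D \<I>\<^bsub>D\<^esub> V"
    and u: "Lie_unit D V br \<nu>" and g: "\<exists>\<gamma> \<in> Mor D V \<I>\<^bsub>D\<^esub>. normalized D \<nu> \<gamma>"
  interpret S: symmetric_preadditive_strict_monoidal_category D c by (rule D)
  interpret Lie_pointed_product D c V br \<nu>
    by unfold_locales (use typing u in auto)
  show "braiding D V (sigma_Lei D c V br \<nu>) \<longleftrightarrow> Leibniz D c V br"
    using g braiding_sigma_Lei_iff by blast
qed

end
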